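(* Let $\mathfrak{g}$ be a solvable Lie algebra and $\langle\cdot,\cdot\rangle$ a nil-invariant symmetric bilinear form on $\mathfrak{g}$. Then $\langle\cdot,\cdot\rangle$ is invariant.
   Context: Lie algebras are finite-dimensional over $\mathbb{R}$. The form $\langle\cdot,\cdot\rangle$ is not assumed non-degenerate. For $X\in\mathfrak{g}$ let $\mathrm{ad}(X)=\mathrm{ad}(X)_{\rm ss}+\mathrm{ad}(X)_{\rm n}$ be the additive Jordan decomposition of the endomorphism $\mathrm{ad}(X)$ of $\mathfrak{g}$ into commuting semisimple and nilpotent parts. The form is nil-invariant if for all $X,Y,Z\in\mathfrak{g}$: $\langle\mathrm{ad}(X)_{\rm n}Y,Z\rangle=-\langle Y,\mathrm{ad}(X)_{\rm n}Z\rangle$. It is invariant if $\langle[X,Y],Z\rangle=-\langle Y,[X,Z]\rangle$ for all $X,Y,Z\in\mathfrak{g}$. *)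

theory Defs
  imports "HOL-Analysis.Analysis"
begin

text \<open>Lie algebras: the underlying vector space is a whole type of class \<open>real_vector\<close>,
  so \<open>subspace\<close>, \<open>span\<close> and \<open>linear\<close> are taken over the reals.\<close>

locale real_lie_algebra =
  fixes bracket :: "'a::real_vector \<Rightarrow> 'a \<Rightarrow> 'a"
  assumes bilinear_bracket: "bilinear bracket"
    and bracket_self: "bracket X X = 0"
    and jacobi: "bracket X (bracket Y Z) + bracket Y (bracket Z X) + bracket Z (bracket X Y) = 0"

locale finite_dim_real_lie_algebra = real_lie_algebra bracket
  for bracket :: "'a::real_vector \<Rightarrow> 'a \<Rightarrow> 'a" +
  assumes finite_dim: "\<exists>B. finite B \<and> span B = (UNIV :: 'a set)"

definition ad :: "('a::real_vector \<Rightarrow> 'a \<Rightarrow> 'a) \<Rightarrow> 'a \<Rightarrow> 'a \<Rightarrow> 'a" where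
  "ad bracket X = (\<lambda>Y. bracket X Y)"

primrec derived_series :: "('a::real_vector \<Rightarrow> 'a \<Rightarrow> 'a) \<Rightarrow> nat \<Rightarrow> 'a set" where
  "derived_series bracket 0 = UNIV"
| "derived_series bracket (Suc k) =
     span {bracket X Y | X Y. X \<in> derived_series bracket k \<and> Y \<in> derived_series bracket k}"

definition solvable_lie :: "('a::real_vector \<Rightarrow> 'a \<Rightarrow> 'a) \<Rightarrow> bool" where
  "solvable_lie bracket \<longleftrightarrow> (\<exists>k. derived_series bracket k = {0})"

definition invariant_subspace :: "('a::real_vector \<Rightarrow> 'a) \<Rightarrow> 'a set \<Rightarrow> bool" where
  "invariant_subspace f U \<longleftrightarrow> subspace U \<and> f ` U \<subseteq> U"

text \<open>Semisimplicity over the reals (not diagonalizability over the reals): every invariant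
  subspace has an invariant complement. In finite dimension this amounts to diagonalizability
  over the complex numbers.\<close>

definition semisimple_endo :: "('a::real_vector \<Rightarrow> 'a) \<Rightarrow> bool" where
  "semisimple_endo f \<longleftrightarrow> linear f \<and>
     (\<forall>U. invariant_subspace f U \<longrightarrow>
       (\<exists>W. invariant_subspace f W \<and> U \<inter> W = {0} \<and> {u + w | u w. u \<in> U \<and> w \<in> W} = UNIV))"

definition nilpotent_endo :: "('a::real_vector \<Rightarrow> 'a) \<Rightarrow> bool" where
  "nilpotent_endo f \<longleftrightarrow> linear f \<and> (\<exists>k. \<forall>v. (f ^^ k) v = 0)"

definition additive_jordan_decomposition ::
    "('a::real_vector \<Rightarrow> 'a) \<Rightarrow> ('a \<Rightarrow> 'a) \<Rightarrow> ('a \<Rightarrow> 'a) \<Rightarrow> bool" where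
  "additive_jordan_decomposition f s n \<longleftrightarrow>
     semisimple_endo s \<and> nilpotent_endo n \<and> s \<circ> n = n \<circ> s \<and> (\<forall>v. f v = s v + n v)"

definition symmetric_bilinear_form :: "('a::real_vector \<Rightarrow> 'a \<Rightarrow> real) \<Rightarrow> bool" where
  "symmetric_bilinear_form form \<longleftrightarrow> bilinear form \<and> (\<forall>X Y. form X Y = form Y X)"

text \<open>An endomorphism of a finite-dimensional real vector space has exactly one additive Jordan
  decomposition, so quantifying over all decompositions of \<open>ad bracket X\<close> below means
  speaking about its nilpotent part.\<close>

definition nil_invariant_form ::
    "('a::real_vector \<Rightarrow> 'a \<Rightarrow> 'a) \<Rightarrow> ('a \<Rightarrow> 'a \<Rightarrow> real) \<Rightarrow> bool" where
  "nil_invariant_form bracket form \<longleftrightarrow>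
     (\<forall>X s n. additive_jordan_decomposition (ad bracket X) s n \<longrightarrow>
       (\<forall>Y Z. form (n Y) Z = - form Y (n Z)))"

definition invariant_form ::
    "('a::real_vector \<Rightarrow> 'a \<Rightarrow> 'a) \<Rightarrow> ('a \<Rightarrow> 'a \<Rightarrow> real) \<Rightarrow> bool" where
  "invariant_form bracket form \<longleftrightarrow>
     (\<forall>X Y Z. form (bracket X Y) Z = - form Y (bracket X Z))"

end

theory Submission
  imports Defs
    "HOL-Computational_Algebra.Polynomial_Factorial"
    "HOL-Computational_Algebra.Field_as_Ring"
begin

text \<open>
  The proof climbs the derived series from its last term \<open>{0}\<close> up to the whole algebra and shows
  for each term that \<open>ad X\<close> is skew for all \<open>X\<close> in it. Suppose this is known for the term below
  the one that contains \<open>X\<close>, and let \<open>H \<oplus> E\<close> be the Fitting decomposition of \<open>ad X\<close>: it is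
  nilpotent on \<open>H\<close> and bijective on \<open>E\<close>. Applying \<open>ad X\<close> twice leads into the lower term, so that
  \<open>E = ad X (ad X E)\<close> lies there and \<open>ad W\<close> is already skew for \<open>W \<in> E\<close>. The pairs of components are as follows.

  \<^item> On \<open>E \<times> E\<close>: for \<open>Y, Z \<in> E\<close> skewness of \<open>ad Y\<close> gives \<open>\<langle>[X, Y], Z\<rangle> = \<langle>X, [Y, Z]\<rangle>\<close>, which changes
    its sign when \<open>Y\<close> and \<open>Z\<close> are exchanged.
  \<^item> On \<open>H \<times> E\<close>: both sides vanish, because \<open>H\<close> is orthogonal to \<open>E\<close>. For \<open>W \<in> E\<close> skewness of
    \<open>ad W\<close> and symmetry give \<open>\<langle>[W, X], X\<rangle> = 0\<close>, and \<open>E = [X, E]\<close>, hence \<open>X\<close> is orthogonal to \<open>E\<close>.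
    For \<open>Y \<in> H\<close> then \<open>\<langle>Y, [X, W]\<rangle> = \<langle>[W, Y], X\<rangle> = 0\<close>, since \<open>[H, E] \<subseteq> E\<close>
    (\<open>bracket_fitting_components\<close>).
  \<^item> On \<open>H \<times> H\<close>: there \<open>ad X\<close> agrees with its nilpotent Jordan part, which is skew by nil-invariance.

  Nil-invariance says something about \<open>X\<close> only if \<open>ad X\<close> has a Jordan decomposition in the real
  sense, where semisimple means that invariant subspaces have invariant complements. It is built as
  a polynomial in the endomorphism: if \<open>q\<close> is coprime to its derivative and \<open>q ^ N\<close> annihilates \<open>f\<close>,
  Newton iteration starting from the indeterminate \<open>x\<close> finds a polynomial \<open>P\<close> congruent to \<open>x\<close>
  modulo \<open>q\<close> with \<open>q(P)\<close> divisible by \<open>q ^ N\<close>. Then \<open>P(f)\<close> is a root of \<open>q\<close>, hence semisimple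
  (\<open>semisimple_if_separable\<close>), and \<open>f - P(f)\<close> is nilpotent.
\<close>

section \<open>Separable polynomials over the reals\<close>

lemma real_poly_bezout:
  fixes p q :: "real poly"
  assumes "coprime p q"
  obtains a b where "a * p + b * q = 1"
  using bezout_coefficients_fst_snd[of p q] assms by (metis coprime_iff_gcd_eq_1)

text \<open>Among the polynomials with a power divisible by \<open>p\<close>, one of least degree has no repeated prime
factor, since dropping one repetition of such a factor would keep the property. In characteristic
zero this makes it coprime to its derivative.\<close>

lemma separable_radical:
  fixes p :: "real poly"
  assumes "p \<noteq> 0"
  obtains q N where "coprime q (pderiv q)" "p dvd q ^ N"
proof -
  define R where "R q \<longleftrightarrow> q \<noteq> 0 \<and> (\<exists>N. p dvd q ^ N)" for q
  have "R p" using assms unfolding R_def by (auto intro!: exI[of _ 1])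
  then obtain q where "R q" and min: "\<And>q'. R q' \<Longrightarrow> degree q \<le> degree q'"
    using ex_has_least_nat[of R p degree] by blast
  then obtain N where q0: "q \<noteq> 0" and N: "p dvd q ^ N" by (auto simp: R_def)
  have "coprime q (pderiv q)"
  proof (rule ccontr)
    assume nc: "\<not> coprime q (pderiv q)"
    have "\<not> is_unit (gcd q (pderiv q))" using nc by (simp add: is_unit_gcd_iff coprime_iff_gcd_eq_1)
    moreover have "gcd q (pderiv q) \<noteq> 0" using q0 by simp
    ultimately obtain r where r: "prime r" "r dvd gcd q (pderiv q)"
      using prime_divisor_exists by blast
    then have "r dvd q" "r dvd pderiv q" by auto
    then obtain t where t: "q = r * t" by blast
    have r0: "r \<noteq> 0" and t0: "t \<noteq> 0" using t q0 by auto
    have dr: "degree r > 0"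
      using r(1) r0 is_unit_iff_degree[OF r0] by (auto intro!: gr0I)
    have "pderiv q = r * pderiv t + t * pderiv r" by (simp add: t pderiv_mult)
    then have "r dvd t * pderiv r"
      using \<open>r dvd pderiv q\<close> by (simp add: dvd_add_right_iff)
    then have "r dvd t \<or> r dvd pderiv r" using r(1) by (simp add: prime_dvd_mult_iff)
    moreover have "\<not> r dvd pderiv r"
    proof
      assume "r dvd pderiv r"
      moreover have "pderiv r \<noteq> 0" using dr by (simp add: pderiv_eq_0_iff)
      ultimately have "degree r \<le> degree (pderiv r)" by (rule dvd_imp_degree_le)
      then show False using dr by (simp add: degree_pderiv)
    qed
    ultimately obtain u where u: "t = r * u" by blast
    \<comment> \<open>The prime \<open>r\<close> occurs twice in \<open>q = r ^ 2 * u\<close>, so \<open>t = r * u\<close> competes with \<open>q\<close> at smaller degree.\<close>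
    have "q * u = t ^ 2" by (simp add: t u power2_eq_square)
    then have "q dvd t ^ 2" by (metis dvd_triv_left)
    then have "q ^ N dvd t ^ (2 * N)" unfolding power_mult by (rule dvd_power_same)
    then have "R t" using dvd_trans[OF N] t0 unfolding R_def by blast
    then have "degree q \<le> degree t" by (rule min)
    then show False using dr t r0 t0 by (simp add: degree_mult_eq)
  qed
  then show ?thesis using N that by blast
qed

lemma pcompose_taylor:
  fixes q P h :: "'a::idom poly"
  shows "h ^ 2 dvd pcompose q (P + h) - pcompose q P - h * pcompose (pderiv q) P"
proof (induction q)
  case (pCons a q)
  then obtain w where "pcompose q (P + h) - pcompose q P - h * pcompose (pderiv q) P = h ^ 2 * w"
    by blast
  then have w: "pcompose q (P + h) = pcompose q P + h * pcompose (pderiv q) P + h ^ 2 * w"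
    by (simp add: algebra_simps)
  have "pcompose (pCons a q) (P + h) - pcompose (pCons a q) P - h * pcompose (pderiv (pCons a q)) P
      = h ^ 2 * ((P + h) * w + pcompose (pderiv q) P)"
    by (simp add: pcompose_pCons pderiv_pCons pcompose_add w algebra_simps power2_eq_square)
  then show ?case by simp
qed simp

text \<open>Newton iteration \<open>P - q(P) / q'(P)\<close> in \<open>\<real>[X]\<close> modulo powers of \<open>q\<close>, starting from \<open>X\<close>: each step
doubles the power of \<open>q\<close> that divides \<open>q(P)\<close>, by Taylor's formula.\<close>

lemma newton_lift:
  fixes q :: "real poly"
  assumes "coprime q (pderiv q)"
  shows "\<exists>P. q dvd P - [:0, 1:] \<and> q ^ Suc k dvd pcompose q P"
proof (induction k)
  case 0
  show ?case by (rule exI[of _ "[:0, 1:]"]) (simp add: pcompose_idR)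
next
  case (Suc k)
  then obtain P where P: "q dvd P - [:0, 1:]" "q ^ Suc k dvd pcompose q P" by blast
  obtain a b where ab: "a * q + b * pderiv q = 1" using real_poly_bezout[OF assms] .
  \<comment> \<open>As \<open>b\<close> inverts \<open>pderiv q\<close> modulo \<open>q\<close>, this is the Newton correction.\<close>
  define h where "h = - (pcompose b P * pcompose q P)"
  have abP: "pcompose a P * pcompose q P + pcompose b P * pcompose (pderiv q) P = 1"
    using arg_cong[OF ab, of "\<lambda>p. pcompose p P"] by (simp add: pcompose_add pcompose_mult pcompose_1)
  obtain w where "pcompose q (P + h) - pcompose q P - h * pcompose (pderiv q) P = h ^ 2 * w"
    using pcompose_taylor[of h q P] by blast
  then have "pcompose q (P + h) = pcompose q P + h * pcompose (pderiv q) P + h ^ 2 * w"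
    by (simp add: algebra_simps)
  also have "pcompose q P + h * pcompose (pderiv q) P
      = pcompose q P * (1 - pcompose b P * pcompose (pderiv q) P)"
    by (simp add: h_def algebra_simps)
  also have "1 - pcompose b P * pcompose (pderiv q) P = pcompose a P * pcompose q P"
    using abP by (simp add: algebra_simps)
  finally have "pcompose q (P + h) = (pcompose q P) ^ 2 * (pcompose a P + (pcompose b P) ^ 2 * w)"
    by (simp add: h_def algebra_simps power2_eq_square)
  then have "(pcompose q P) ^ 2 dvd pcompose q (P + h)" by simp
  moreover have "q ^ (2 * Suc k) dvd (pcompose q P) ^ 2"
    unfolding mult.commute[of 2] power_mult using P(2) by (rule dvd_power_same)
  moreover have "q ^ Suc (Suc k) dvd q ^ (2 * Suc k)" by (rule le_imp_power_dvd) simp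
  ultimately have 1: "q ^ Suc (Suc k) dvd pcompose q (P + h)" by (blast intro: dvd_trans)
  have "q dvd pcompose q P" using dvd_mult_left[OF P(2)[unfolded power_Suc]] .
  then have "q dvd h" by (simp add: h_def)
  then have "q dvd (P - [:0, 1:]) + h" using P(1) by (rule dvd_add[rotated])
  then show ?case using 1 by (intro exI[of _ "P + h"]) (simp add: algebra_simps)
qed

section \<open>Polynomials in an endomorphism\<close>

definition poly_endo :: "('a::real_vector \<Rightarrow> 'a) \<Rightarrow> real poly \<Rightarrow> 'a \<Rightarrow> 'a" where
  "poly_endo f p v = (\<Sum>i\<le>degree p. coeff p i *\<^sub>R (f ^^ i) v)"

lemma poly_endo_eq_sum:
  assumes "degree p \<le> N"
  shows "poly_endo f p v = (\<Sum>i\<le>N. coeff p i *\<^sub>R (f ^^ i) v)"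
  unfolding poly_endo_def
  by (rule sum.mono_neutral_left) (use assms in \<open>auto simp: coeff_eq_0 not_le\<close>)

lemma poly_endo_0 [simp]: "poly_endo f 0 v = 0"
  by (simp add: poly_endo_def)

lemma linear_funpow:
  fixes f :: "'a::real_vector \<Rightarrow> 'a"
  assumes "linear f"
  shows "linear (f ^^ k)"
proof (induction k)
  case 0
  show ?case by (simp add: linear_ident)
next
  case (Suc k)
  show ?case using linear_compose[OF Suc assms] by (simp add: o_def)
qed

context
  fixes f :: "'a::real_vector \<Rightarrow> 'a"
  assumes f: "linear f"
begin

lemma poly_endo_pCons [simp]: "poly_endo f (pCons a p) v = a *\<^sub>R v + f (poly_endo f p v)"
proof -
  have "poly_endo f (pCons a p) v = (\<Sum>i\<le>Suc (degree p). coeff (pCons a p) i *\<^sub>R (f ^^ i) v)"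
    by (rule poly_endo_eq_sum) (rule degree_pCons_le)
  also have "\<dots> = a *\<^sub>R v + (\<Sum>i\<le>degree p. coeff p i *\<^sub>R f ((f ^^ i) v))"
    by (subst sum.atMost_Suc_shift) simp
  also have "\<dots> = a *\<^sub>R v + f (poly_endo f p v)"
    by (simp add: poly_endo_def linear_sum[OF f] linear_cmul[OF f])
  finally show ?thesis .
qed

lemma poly_endo_1 [simp]: "poly_endo f 1 v = v"
  by (simp add: one_pCons linear_0[OF f])

lemma linear_poly_endo: "linear (poly_endo f p)"
proof (induction p)
  case 0
  have "poly_endo f 0 = (\<lambda>v. 0)" by (simp add: fun_eq_iff)
  then show ?case by (simp only: linear_zero)
next
  case (pCons a p)
  have eq: "poly_endo f (pCons a p) = (\<lambda>v. a *\<^sub>R v + (f \<circ> poly_endo f p) v)"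
    by (simp add: fun_eq_iff)
  show ?case
    unfolding eq by (intro linear_compose_add linear_compose_scale_right linear_ident linear_compose pCons f)
qed

lemma poly_endo_add: "poly_endo f (p + q) v = poly_endo f p v + poly_endo f q v"
proof (induction p arbitrary: q)
  case (pCons a p)
  then show ?case
    by (cases q) (simp add: linear_add[OF f] scaleR_add_left)
qed simp

lemma poly_endo_smult: "poly_endo f (smult c p) v = c *\<^sub>R poly_endo f p v"
  by (induction p) (simp_all add: linear_cmul[OF f] scaleR_add_right)

lemma poly_endo_diff: "poly_endo f (p - q) v = poly_endo f p v - poly_endo f q v"
  using poly_endo_add[of "p - q" q v] by simp

lemma poly_endo_mult: "poly_endo f (p * q) v = poly_endo f p (poly_endo f q v)"
  by (induction p) (simp_all add: poly_endo_add poly_endo_smult)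

lemma poly_endo_commute: "poly_endo f p (poly_endo f q v) = poly_endo f q (poly_endo f p v)"
  by (metis mult.commute poly_endo_mult)

lemma poly_endo_power: "poly_endo f (p ^ k) v = (poly_endo f p ^^ k) v"
  by (induction k) (simp_all add: poly_endo_mult)

lemma poly_endo_X: "poly_endo f [:0, 1:] v = f v"
  by (simp add: linear_0[OF f])

lemma poly_endo_dvd:
  assumes "p dvd q" "poly_endo f p v = 0"
  shows "poly_endo f q v = 0"
proof -
  obtain t where "q = t * p" using assms(1) by (metis dvdE mult.commute)
  then show ?thesis using assms(2) linear_0[OF linear_poly_endo] by (simp add: poly_endo_mult)
qed

end

lemma poly_endo_pcompose:
  assumes f: "linear f"
  shows "poly_endo f (pcompose p q) v = poly_endo (poly_endo f q) p v"
  using linear_poly_endo[OF f, of q]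
  by (induction p) (simp_all add: pcompose_pCons f poly_endo_add poly_endo_mult linear_0[OF f])

lemma poly_endo_mem:
  assumes f: "linear f" and U: "subspace U" "f ` U \<subseteq> U" "u \<in> U"
  shows "poly_endo f p u \<in> U"
  using U by (induction p) (auto simp: f subspace_0 subspace_add subspace_scale image_subset_iff)

text \<open>The \<open>card B + 1\<close> vectors \<open>v, f v, f (f v), \<dots>\<close> satisfy a nontrivial linear relation. If two of
them coincide, the relation is their difference; otherwise they form a set too large to be
independent.\<close>

lemma exists_annihilating_poly_at:
  assumes f: "linear f" and B: "finite B" "span B = (UNIV :: 'a::real_vector set)"
  shows "\<exists>p. p \<noteq> 0 \<and> poly_endo f p (v::'a) = 0"
proof -
  define n where "n = card B"
  define g where "g i = (f ^^ i) v" for i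
  have "\<exists>c. (\<exists>i\<le>n. c i \<noteq> 0) \<and> (\<Sum>i\<le>n. c i *\<^sub>R g i) = 0"
  proof (cases "inj_on g {..n}")
    case True
    have "dependent (g ` {..n})"
    proof (rule ccontr)
      assume "\<not> dependent (g ` {..n})"
      then have "card (g ` {..n}) \<le> card B"
        using independent_span_bound[OF B(1)] B(2) by auto
      then show False using True by (simp add: card_image n_def)
    qed
    then obtain u where u: "\<exists>w\<in>g ` {..n}. u w \<noteq> 0" "(\<Sum>w\<in>g ` {..n}. u w *\<^sub>R w) = 0"
      using dependent_finite[of "g ` {..n}"] by auto
    then show ?thesis
      unfolding sum.reindex[OF True] by (intro exI[of _ "u \<circ> g"] conjI) auto
  next
    case False
    then obtain i j where ij: "i \<le> n" "j \<le> n" "i \<noteq> j" "g i = g j" by (auto simp: inj_on_def)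
    define c :: "nat \<Rightarrow> real" where "c k = (if k = i then 1 else 0) - (if k = j then 1 else 0)" for k
    have "(\<Sum>k\<le>n. c k *\<^sub>R g k) = (\<Sum>k\<le>n. (if k = i then g k else 0) - (if k = j then g k else 0))"
      by (rule sum.cong) (auto simp: c_def)
    also have "\<dots> = 0" using ij by (simp add: sum_subtractf)
    finally have "(\<Sum>k\<le>n. c k *\<^sub>R g k) = 0" .
    moreover have "c i \<noteq> 0" using ij(3) by (simp add: c_def)
    ultimately show ?thesis using ij(1) by blast
  qed
  then obtain c i where c: "i \<le> n" "c i \<noteq> 0" "(\<Sum>i\<le>n. c i *\<^sub>R g i) = 0" by blast
  define p where "p = (\<Sum>i\<le>n. monom (c i) i)"
  have coeff: "coeff p k = (if k \<le> n then c k else 0)" for k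
    by (simp add: p_def coeff_sum)
  have "degree p \<le> n" by (rule degree_le) (simp add: coeff)
  then have "poly_endo f p v = 0" using c(3) by (simp add: poly_endo_eq_sum coeff g_def)
  moreover have "p \<noteq> 0" using c(1,2) coeff[of i] by force
  ultimately show ?thesis by blast
qed

lemma exists_annihilating_poly:
  fixes f :: "'a::real_vector \<Rightarrow> 'a"
  assumes f: "linear f" and fd: "\<exists>B. finite B \<and> span B = (UNIV :: 'a set)"
  obtains p where "p \<noteq> 0" "\<And>v. poly_endo f p v = 0"
proof -
  obtain B where B: "finite B" "span B = (UNIV :: 'a set)" using fd by blast
  have "\<forall>v. \<exists>p. p \<noteq> 0 \<and> poly_endo f p v = 0"
    using exists_annihilating_poly_at[OF f B] by blast
  then obtain P where P: "\<And>v. P v \<noteq> 0" "\<And>v. poly_endo f (P v) v = 0"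
    by (auto dest!: choice)
  define p where "p = prod P B"
  have "poly_endo f p v = 0" for v
  proof (rule linear_eq_0_on_span[OF linear_poly_endo[OF f], where b = B])
    show "v \<in> span B" using B(2) by simp
    show "poly_endo f p b = 0" if "b \<in> B" for b
      unfolding p_def using dvd_prodI[OF B(1) that, of P] P(2) by (rule poly_endo_dvd[OF f])
  qed
  moreover have "p \<noteq> 0" using P(1) B(1) by (simp add: p_def)
  ultimately show ?thesis using that by blast
qed

section \<open>The additive Jordan decomposition\<close>

text \<open>An equivariant projection onto an invariant subspace \<open>U\<close> has an invariant kernel, which is the
complement. It arises from an arbitrary projection \<open>\<pi>\<close> by averaging with the separability element
of \<open>\<real>[X] / (q)\<close>. Write the divided difference \<open>(q(x) - q(y)) / (x - y)\<close> as a sum of monomials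
\<open>c x ^ i y ^ j\<close> and let \<open>\<Phi>\<close> be the sum of the maps \<open>c (s ^^ i) \<pi> (s ^^ j)\<close>. Multiplication by
\<open>x - y\<close> becomes the commutator with \<open>s\<close>, so that \<open>s \<Phi> - \<Phi> s = q(s) \<pi> - \<pi> q(s) = 0\<close>; and as \<open>\<pi>\<close> is the
identity on \<open>U\<close>, there \<open>\<Phi>\<close> is the value \<open>q'(s)\<close> on the diagonal \<open>x = y\<close>, which is invertible by
coprimality.\<close>

lemma semisimple_if_separable:
  fixes s :: "'a::real_vector \<Rightarrow> 'a"
  assumes s: "linear s" and q: "coprime q (pderiv q)" "\<And>v. poly_endo s q v = 0"
  shows "semisimple_endo s"
  unfolding semisimple_endo_def
proof (intro conjI allI impI s)
  fix U :: "'a set" assume "invariant_subspace s U"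
  then have U: "subspace U" "s ` U \<subseteq> U" by (auto simp: invariant_subspace_def)
  note U_s = poly_endo_mem[OF s U]
  obtain \<pi> where \<pi>: "range \<pi> \<subseteq> U" "linear \<pi>" "\<And>u. u \<in> U \<Longrightarrow> \<pi> u = u"
    using linear_exists_left_inverse_on[of id U, OF linear_id U(1)] by auto
  \<comment> \<open>The map \<open>\<Phi>\<close> of the divided difference, for an arbitrary polynomial to allow induction.\<close>
  have "\<exists>\<Phi>. linear \<Phi> \<and> range \<Phi> \<subseteq> U
      \<and> (\<forall>v. s (\<Phi> v) - \<Phi> (s v) = poly_endo s p (\<pi> v) - \<pi> (poly_endo s p v))
      \<and> (\<forall>u\<in>U. \<Phi> u = poly_endo s (pderiv p) u)" for p
  proof (induction p)
    case 0
    show ?case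
      using linear_0[OF s] linear_0[OF \<pi>(2)] subspace_0[OF U(1)]
      by (intro exI[of _ "\<lambda>_. 0"]) (auto simp: linear_zero)
  next
    case (pCons a p)
    then obtain \<Phi> where \<Phi>: "linear \<Phi>" "range \<Phi> \<subseteq> U"
      "\<And>v. s (\<Phi> v) - \<Phi> (s v) = poly_endo s p (\<pi> v) - \<pi> (poly_endo s p v)"
      "\<And>u. u \<in> U \<Longrightarrow> \<Phi> u = poly_endo s (pderiv p) u" by blast
    \<comment> \<open>The divided difference of \<open>a + X * p\<close> is \<open>x\<close> times that of \<open>p\<close>, plus \<open>p(y)\<close>.\<close>
    define \<Psi> where "\<Psi> v = s (\<Phi> v) + \<pi> (poly_endo s p v)" for v
    have "linear \<Psi>"
      unfolding \<Psi>_def using linear_compose[OF \<Phi>(1) s] linear_compose[OF linear_poly_endo[OF s] \<pi>(2)]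
      by (intro linear_compose_add) (simp_all add: o_def)
    moreover have "range \<Psi> \<subseteq> U"
      using \<Phi>(2) \<pi>(1) U by (auto simp: \<Psi>_def intro!: subspace_add)
    moreover have "s (\<Psi> v) - \<Psi> (s v) = poly_endo s (pCons a p) (\<pi> v) - \<pi> (poly_endo s (pCons a p) v)" for v
    proof -
      have "s (\<Psi> v) - \<Psi> (s v)
          = s (s (\<Phi> v) - \<Phi> (s v)) + s (\<pi> (poly_endo s p v)) - \<pi> (poly_endo s p (s v))"
        by (simp add: \<Psi>_def linear_add[OF s] linear_diff[OF s])
      also have "poly_endo s p (s v) = s (poly_endo s p v)"
        using poly_endo_commute[OF s, of p "[:0,1:]" v] by (simp only: poly_endo_X[OF s])
      finally show ?thesis
        by (simp add: \<Phi>(3) s linear_diff[OF s] linear_add[OF \<pi>(2)] linear_cmul[OF \<pi>(2)])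
    qed
    moreover have "\<Psi> u = poly_endo s (pderiv (pCons a p)) u" if "u \<in> U" for u
      using that by (simp add: \<Psi>_def \<Phi>(4) \<pi>(3) U_s pderiv_pCons poly_endo_add s)
    ultimately show ?case by blast
  qed
  then obtain \<Phi> where \<Phi>: "linear \<Phi>" "range \<Phi> \<subseteq> U"
      "\<And>v. s (\<Phi> v) - \<Phi> (s v) = poly_endo s q (\<pi> v) - \<pi> (poly_endo s q v)"
      "\<And>u. u \<in> U \<Longrightarrow> \<Phi> u = poly_endo s (pderiv q) u" by blast
  obtain a b where ab: "a * q + b * pderiv q = 1" using real_poly_bezout[OF q(1)] .
  \<comment> \<open>As \<open>b\<close> inverts \<open>pderiv q\<close> modulo \<open>q\<close>, this normalises \<open>\<Phi>\<close> to a projection.\<close>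
  define \<rho> where "\<rho> v = \<Phi> (poly_endo s b v)" for v
  have \<rho>: "linear \<rho>"
    unfolding \<rho>_def using linear_compose[OF linear_poly_endo[OF s] \<Phi>(1)] by (simp add: o_def)
  have \<rho>U: "\<rho> v \<in> U" for v using \<Phi>(2) by (auto simp: \<rho>_def)
  have \<rho>_id: "\<rho> u = u" if "u \<in> U" for u
  proof -
    have "\<rho> u = poly_endo s (b * pderiv q) u"
      using that by (simp add: \<rho>_def \<Phi>(4) U_s poly_endo_mult[OF s] poly_endo_commute[OF s, of b])
    also have "\<dots> = poly_endo s (a * q + b * pderiv q) u"
      by (simp add: poly_endo_add[OF s] poly_endo_mult[OF s, of a] q(2) linear_0[OF linear_poly_endo[OF s]])
    finally show ?thesis by (simp add: ab s)
  qed
  have \<rho>_s: "\<rho> (s v) = s (\<rho> v)" for v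
  proof -
    have "poly_endo s b (s v) = s (poly_endo s b v)"
      using poly_endo_commute[OF s, of b "[:0,1:]" v] by (simp only: poly_endo_X[OF s])
    then show ?thesis using \<Phi>(3)[of "poly_endo s b v"] by (simp add: \<rho>_def q(2) linear_0[OF \<pi>(2)])
  qed
  define W where "W = {v. \<rho> v = 0}"
  have "invariant_subspace s W"
    by (auto simp: invariant_subspace_def W_def \<rho>_s linear_0[OF s] linear_subspace_kernel[OF \<rho>])
  moreover have "U \<inter> W = {0}"
    using \<rho>_id subspace_0[OF U(1)] linear_0[OF \<rho>] by (auto simp: W_def)
  moreover have "{u + w |u w. u \<in> U \<and> w \<in> W} = UNIV"
  proof -
    have "v = \<rho> v + (v - \<rho> v) \<and> \<rho> v \<in> U \<and> v - \<rho> v \<in> W" for v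
      by (simp add: W_def \<rho>U linear_diff[OF \<rho>] \<rho>_id)
    then show ?thesis by blast
  qed
  ultimately show "\<exists>W. invariant_subspace s W \<and> U \<inter> W = {0} \<and> {u + w |u w. u \<in> U \<and> w \<in> W} = UNIV"
    by blast
qed

lemma additive_jordan_decomposition_exists:
  fixes f :: "'a::real_vector \<Rightarrow> 'a"
  assumes f: "linear f" and fd: "\<exists>B. finite B \<and> span B = (UNIV :: 'a set)"
  obtains s n where "additive_jordan_decomposition f s n"
proof -
  obtain p where p: "p \<noteq> 0" "\<And>v. poly_endo f p v = 0" using exists_annihilating_poly[OF f fd] by blast
  obtain q N where q: "coprime q (pderiv q)" "p dvd q ^ N" using separable_radical[OF p(1)] .
  have qN: "poly_endo f (q ^ N) v = 0" for v using poly_endo_dvd[OF f q(2) p(2)] .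
  obtain P where P: "q dvd P - [:0, 1:]" "q ^ Suc N dvd pcompose q P"
    using newton_lift[OF q(1)] by blast
  define s where "s = poly_endo f P"
  define n where "n = poly_endo f ([:0, 1:] - P)"
  have s: "linear s" and n: "linear n" by (simp_all add: s_def n_def linear_poly_endo[OF f])
  have "q ^ N dvd pcompose q P" using dvd_mult_right[OF P(2)[unfolded power_Suc]] .
  then have "poly_endo s q v = 0" for v
    unfolding s_def poly_endo_pcompose[OF f, symmetric] using qN by (rule poly_endo_dvd[OF f])
  then have "semisimple_endo s" using s q(1) by (intro semisimple_if_separable)
  moreover have "nilpotent_endo n"
  proof -
    have "q dvd [:0, 1:] - P" using P(1) by (simp only: dvd_diff_commute)
    then have "q ^ N dvd ([:0, 1:] - P) ^ N" by (rule dvd_power_same)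
    then have "(n ^^ N) v = 0" for v
      unfolding n_def poly_endo_power[OF f, symmetric] using qN by (rule poly_endo_dvd[OF f])
    then show ?thesis using n by (auto simp: nilpotent_endo_def)
  qed
  moreover have "s \<circ> n = n \<circ> s"
    by (simp add: fun_eq_iff s_def n_def poly_endo_commute[OF f])
  moreover have "f v = s v + n v" for v
    by (simp only: s_def n_def poly_endo_diff[OF f] poly_endo_X[OF f]) simp
  ultimately have "additive_jordan_decomposition f s n"
    by (simp add: additive_jordan_decomposition_def)
  then show ?thesis by (rule that)
qed

text \<open>On an invariant complement of its kernel the map \<open>s\<close> is injective, and so are its powers.\<close>

lemma semisimple_generalized_kernel:
  assumes s: "semisimple_endo s" and v: "(s ^^ k) v = 0"
  shows "s v = 0"
proof -
  have lin: "linear s" using s by (simp add: semisimple_endo_def)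
  have "invariant_subspace s {v. s v = 0}"
    using linear_0[OF lin] by (auto simp: invariant_subspace_def linear_subspace_kernel[OF lin])
  then obtain W where W: "invariant_subspace s W" "{v. s v = 0} \<inter> W = {0}"
    "{u + w |u w. u \<in> {v. s v = 0} \<and> w \<in> W} = UNIV"
    using s unfolding semisimple_endo_def by blast
  obtain u w where uw: "v = u + w" "s u = 0" "w \<in> W" using W(3) by blast
  have sW: "x \<in> W \<Longrightarrow> s x \<in> W" for x using W(1) by (auto simp: invariant_subspace_def)
  have inj: "x = 0" if "(s ^^ j) x = 0" "x \<in> W" for j x
    using that
  proof (induction j arbitrary: x)
    case (Suc j)
    then have "s x = 0" using sW by (metis funpow_swap1 funpow.simps(2) o_apply)
    then show ?case using Suc.prems(2) W(2) by blast
  qed simp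
  have "s v = s w" using uw linear_add[OF lin] by simp
  moreover have "(s ^^ k) (s v) = 0" using v linear_0[OF lin] by (metis funpow_swap1)
  ultimately have "s w = 0" using inj sW uw(3) by metis
  then show ?thesis using \<open>s v = s w\<close> by simp
qed

text \<open>On the generalized kernel of \<open>f\<close> the semisimple part \<open>s\<close> vanishes. By induction on the exponent it
may be assumed that \<open>s (f v) = 0\<close>; then \<open>s\<close> acts on \<open>s v\<close> as \<open>- n\<close> does, hence nilpotently, and a
semisimple map kills every vector killed by one of its powers.\<close>

lemma jordan_nilpotent_part_on_generalized_kernel:
  assumes J: "additive_jordan_decomposition f s n" and v: "(f ^^ k) v = 0"
  shows "n v = f v"
proof -
  have ss: "semisimple_endo s" and s: "linear s" and n: "linear n"
    and comm: "\<And>v. s (n v) = n (s v)" and f: "\<And>v. f v = s v + n v"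
    using J by (auto simp: additive_jordan_decomposition_def semisimple_endo_def
        nilpotent_endo_def fun_eq_iff)
  obtain l where l: "\<And>v. (n ^^ l) v = 0"
    using J by (auto simp: additive_jordan_decomposition_def nilpotent_endo_def)
  have "s v = 0" using v
  proof (induction k arbitrary: v)
    case 0
    then show ?case using linear_0[OF s] by simp
  next
    case (Suc k)
    then have "s (f v) = 0" by (metis funpow_swap1 funpow.simps(2) o_apply)
    then have sn: "s (s v) = - n (s v)"
      by (simp add: f linear_add[OF s] comm eq_neg_iff_add_eq_0)
    have s_pow: "s ((n ^^ j) w) = (n ^^ j) (s w)" for j w
      by (induction j) (simp_all add: comm)
    have pow: "(s ^^ j) (s v) = (-1) ^ j *\<^sub>R (n ^^ j) (s v)" for j
    proof (induction j)
      case (Suc j)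
      have "s ((n ^^ j) (s v)) = - (n ^^ Suc j) (s v)"
        using sn linear_neg[OF linear_funpow[OF n, of j], of "n (s v)"]
        by (simp add: s_pow funpow_swap1)
      then show ?case using Suc by (simp add: linear_cmul[OF s])
    qed simp
    have "(s ^^ l) (s v) = 0" by (simp add: pow l)
    then have "(s ^^ Suc l) v = 0" by (simp add: funpow_swap1)
    then show ?case by (rule semisimple_generalized_kernel[OF ss])
  qed
  then show ?thesis by (simp add: f)
qed

text \<open>Split an annihilating polynomial as \<open>X ^ m * t\<close> with \<open>t\<close> coprime to \<open>X\<close>. A Bezout identity for \<open>X ^ m\<close> and
\<open>t\<close> splits every vector into a part killed by \<open>f ^^ m\<close> and a part in its range, and one for \<open>X\<close> and \<open>t\<close>
inverts \<open>f\<close> on that range.\<close>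

lemma fitting_decomposition:
  fixes f :: "'a::real_vector \<Rightarrow> 'a"
  assumes f: "linear f" and fd: "\<exists>B. finite B \<and> span B = (UNIV :: 'a set)"
  obtains m where "\<And>v. \<exists>u w. v = u + w \<and> (f ^^ m) u = 0 \<and> w \<in> range (f ^^ m)"
    "range (f ^^ m) \<subseteq> f ` range (f ^^ m)"
proof -
  obtain p where p: "p \<noteq> 0" "\<And>v. poly_endo f p v = 0" using exists_annihilating_poly[OF f fd] by blast
  let ?X = "[:0, 1:] :: real poly"
  obtain m t where t: "p = ?X ^ m * t" "\<not> ?X dvd t"
    using order_decomp[OF p(1), of 0] by auto
  have Xm: "poly_endo f (?X ^ j) v = (f ^^ j) v" for j v
    by (induction j) (simp_all add: f)
  have "prime_elem ?X" by (rule prime_elem_linear_field_poly) simp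
  then have "coprime ?X t" using t(2) by (simp add: prime_elem_imp_coprime)
  then have "coprime (?X ^ m) t" by simp
  then obtain a b where ab: "a * ?X ^ m + b * t = 1" by (rule real_poly_bezout)
  obtain c d where cd: "c * ?X + d * t = 1" using real_poly_bezout[OF \<open>coprime ?X t\<close>] .
  note lin0 = linear_0[OF linear_poly_endo[OF f]]
  show ?thesis
  proof (rule that)
    fix v
    have "v = poly_endo f (b * t) v + poly_endo f (?X ^ m * a) v"
      by (metis ab poly_endo_1[OF f] poly_endo_add[OF f] add.commute mult.commute)
    moreover have "(f ^^ m) (poly_endo f (b * t) v) = 0"
    proof -
      have "(f ^^ m) (poly_endo f (b * t) v) = poly_endo f (b * p) v"
        by (simp only: Xm[symmetric] poly_endo_mult[OF f, symmetric] t(1)) (simp only: ac_simps)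
      then show ?thesis by (simp add: poly_endo_mult[OF f] p(2) lin0)
    qed
    moreover have "poly_endo f (?X ^ m * a) v \<in> range (f ^^ m)"
      by (simp only: poly_endo_mult[OF f] Xm) simp
    ultimately show "\<exists>u w. v = u + w \<and> (f ^^ m) u = 0 \<and> w \<in> range (f ^^ m)" by blast
  next
    show "range (f ^^ m) \<subseteq> f ` range (f ^^ m)"
    proof clarify
      fix v
      have "(f ^^ m) v = poly_endo f ((c * ?X + d * t) * ?X ^ m) v" by (simp only: cd mult_1 Xm)
      also have "(c * ?X + d * t) * ?X ^ m = ?X * (?X ^ m * c) + d * p"
        by (simp only: t(1) algebra_simps)
      also have "poly_endo f \<dots> v = f ((f ^^ m) (poly_endo f c v))"
        by (simp only: poly_endo_add[OF f] poly_endo_mult[OF f] p(2) lin0 Xm poly_endo_X[OF f]) simp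
      finally show "(f ^^ m) v \<in> f ` range (f ^^ m)" by blast
    qed
  qed
qed

section \<open>Invariance along the derived series\<close>

context real_lie_algebra
begin

lemmas bracket_simps = bilinear_ladd[OF bilinear_bracket] bilinear_radd[OF bilinear_bracket]
  bilinear_lneg[OF bilinear_bracket] bilinear_rneg[OF bilinear_bracket]
  bilinear_lzero[OF bilinear_bracket] bilinear_rzero[OF bilinear_bracket]

lemma linear_ad: "linear (ad bracket X)"
  using bilinear_bracket by (simp add: bilinear_def ad_def)

lemma bracket_skew: "bracket X Y = - bracket Y X"
  using bracket_self[of "X + Y"] bracket_self[of X] bracket_self[of Y]
  by (simp add: bracket_simps eq_neg_iff_add_eq_0 add.commute)

lemma ad_derivation: "bracket X (bracket Y Z) = bracket (bracket X Y) Z + bracket Y (bracket X Z)"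
  using jacobi[of X Y Z] bracket_skew[of Z "bracket X Y"] bracket_skew[of Z X]
  by (simp add: bracket_simps algebra_simps)

lemma derived_series_ideal:
  assumes "X \<in> derived_series bracket k"
  shows "bracket Z X \<in> derived_series bracket k"
  using assms
proof (induction k arbitrary: X)
  case (Suc k)
  let ?S = "{bracket X Y | X Y. X \<in> derived_series bracket k \<and> Y \<in> derived_series bracket k}"
  have "ad bracket Z ` span ?S \<subseteq> span ?S"
  proof -
    have "ad bracket Z ` ?S \<subseteq> span ?S"
    proof clarify
      fix A B assume "A \<in> derived_series bracket k" "B \<in> derived_series bracket k"
      then have "bracket (bracket Z A) B \<in> ?S" "bracket A (bracket Z B) \<in> ?S"
        using Suc.IH by blast+
      then show "ad bracket Z (bracket A B) \<in> span ?S"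
        by (simp add: ad_def ad_derivation[of Z A B] span_add span_base)
    qed
    then have "span (ad bracket Z ` ?S) \<subseteq> span ?S"
      by (rule span_minimal) (rule subspace_span)
    then show ?thesis by (simp only: linear_span_image[OF linear_ad])
  qed
  then show ?case using Suc.prems by (auto simp: ad_def)
qed simp

lemma bracket_derived_series:
  assumes "X \<in> derived_series bracket k" "Y \<in> derived_series bracket k"
  shows "bracket X Y \<in> derived_series bracket (Suc k)"
  using assms by (auto intro: span_base)

text \<open>With \<open>D = ad X\<close>, the Leibniz rule gives \<open>[Y, D V] = D [Y, V] - [D Y, V]\<close>. The last term lies in \<open>E\<close>
by induction on the exponent \<open>k\<close> that kills \<open>Y\<close>, so modulo \<open>E\<close> the map \<open>D\<close> can be pulled out of
\<open>[Y, W]\<close>. As \<open>W\<close> can be written as \<open>D V\<close> repeatedly inside \<open>E\<close>, it can be pulled out \<open>m\<close> times,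
and the range of \<open>D ^^ m\<close> is contained in \<open>E\<close>.\<close>

lemma bracket_fitting_components:
  assumes E: "\<And>Z. (ad bracket X ^^ m) Z \<in> E" and sub: "subspace E"
    and XE: "\<And>W. W \<in> E \<Longrightarrow> bracket X W \<in> E"
    and surj: "\<And>W. W \<in> E \<Longrightarrow> \<exists>W'\<in>E. W = bracket X W'"
    and Y: "(ad bracket X ^^ k) Y = 0" and W: "W \<in> E"
  shows "bracket Y W \<in> E"
  using Y W
proof (induction k arbitrary: Y W)
  case 0
  then show ?case using subspace_0[OF sub] by (simp add: bracket_simps)
next
  case (Suc k)
  have XY: "(ad bracket X ^^ k) (bracket X Y) = 0"
    using Suc.prems(1) by (simp add: funpow_swap1 ad_def)
  have step: "\<exists>W'\<in>E. bracket Y W - (ad bracket X ^^ j) (bracket Y W') \<in> E" if "W \<in> E" for j W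
    using that
  proof (induction j arbitrary: W)
    case 0
    then show ?case using subspace_0[OF sub] by (intro bexI[of _ W]) simp_all
  next
    case (Suc j)
    obtain W' where W': "W' \<in> E" "bracket Y W - (ad bracket X ^^ j) (bracket Y W') \<in> E"
      using Suc by blast
    obtain V where V: "V \<in> E" "W' = bracket X V" using surj W'(1) by blast
    have "bracket Y W' = bracket X (bracket Y V) - bracket (bracket X Y) V"
      by (simp add: V(2) ad_derivation[of X Y V])
    then have eq: "(ad bracket X ^^ j) (bracket Y W')
        = (ad bracket X ^^ Suc j) (bracket Y V) - (ad bracket X ^^ j) (bracket (bracket X Y) V)"
      by (simp add: linear_diff[OF linear_funpow[OF linear_ad]] funpow_swap1) (simp add: ad_def)
    have "(ad bracket X ^^ j) (bracket (bracket X Y) V) \<in> E"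
      using \<open>\<And>W Y. (ad bracket X ^^ k) Y = 0 \<Longrightarrow> W \<in> E \<Longrightarrow> bracket Y W \<in> E\<close>[OF XY V(1)]
      by (induction j) (simp_all add: ad_def XE)
    from subspace_diff[OF sub W'(2) this]
    have "bracket Y W - (ad bracket X ^^ Suc j) (bracket Y V) \<in> E"
      by (simp only: eq) simp
    then show ?case using V(1) by blast
  qed
  obtain W' where "bracket Y W - (ad bracket X ^^ m) (bracket Y W') \<in> E"
    using step[OF Suc.prems(2)] by blast
  then have "bracket Y W - (ad bracket X ^^ m) (bracket Y W') + (ad bracket X ^^ m) (bracket Y W') \<in> E"
    using E by (rule subspace_add[OF sub])
  then show ?case by simp
qed

end

definition ad_skew :: "('a::real_vector \<Rightarrow> 'a \<Rightarrow> 'a) \<Rightarrow> ('a \<Rightarrow> 'a \<Rightarrow> real) \<Rightarrow> 'a \<Rightarrow> bool" where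
  "ad_skew bracket form X \<longleftrightarrow> (\<forall>Y Z. form (bracket X Y) Z = - form Y (bracket X Z))"

text \<open>One step up the derived series. Here \<open>H\<close> and \<open>E\<close> are the Fitting components of \<open>ad X\<close>, and the
names of the intermediate facts tell which components they pair.\<close>

lemma (in finite_dim_real_lie_algebra) ad_skew_if_ad_skew_on_next_derived:
  assumes bil: "bilinear form" and sym: "\<And>Y Z. form Y Z = form Z Y"
    and nil: "nil_invariant_form bracket form"
    and X: "X \<in> derived_series bracket k"
    and IH: "\<And>W. W \<in> derived_series bracket (Suc k) \<Longrightarrow> ad_skew bracket form W"
  shows "ad_skew bracket form X"
proof -
  let ?D = "ad bracket X"
  note form_simps = bilinear_ladd[OF bil] bilinear_radd[OF bil] bilinear_lneg[OF bil]
    bilinear_rneg[OF bil] bilinear_lzero[OF bil] bilinear_rzero[OF bil]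
  obtain m where m: "\<And>v. \<exists>u w. v = u + w \<and> (?D ^^ m) u = 0 \<and> w \<in> range (?D ^^ m)"
    "range (?D ^^ m) \<subseteq> ?D ` range (?D ^^ m)"
    using fitting_decomposition[OF linear_ad finite_dim] by blast
  define E where "E = range (?D ^^ m)"
  have E_sub: "subspace E"
    unfolding E_def by (rule linear_subspace_image[OF linear_funpow[OF linear_ad] subspace_UNIV])
  have E_X: "bracket X W \<in> E" if "W \<in> E" for W
    using that by (auto simp: E_def ad_def funpow_swap1)
  have E_surj: "\<exists>W'\<in>E. W = bracket X W'" if "W \<in> E" for W
    using that m(2) by (auto simp: E_def ad_def)
  \<comment> \<open>Two factors \<open>ad X\<close> are needed: in general one of them only leads into the term of \<open>X\<close> itself.\<close>
  have E_derived: "W \<in> derived_series bracket (Suc k)" if W: "W \<in> E" for W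
  proof -
    obtain V where V: "V \<in> E" "W = bracket X V" using E_surj[OF W] by blast
    obtain V' where V': "V = bracket X V'" using E_surj[OF V(1)] by blast
    have "bracket X V' \<in> derived_series bracket k"
      using derived_series_ideal[OF X] bracket_skew[of X V']
      by (cases k) (simp_all add: span_neg)
    then show ?thesis unfolding V(2) V' by (rule bracket_derived_series[OF X])
  qed
  have E_skew: "form (bracket W Y) Z = - form Y (bracket W Z)" if "W \<in> E" for W Y Z
    using IH[OF E_derived[OF that]] by (simp add: ad_skew_def)
  have X_E: "form W X = 0" if W: "W \<in> E" for W
  proof -
    obtain V where V: "V \<in> E" "W = bracket X V" using E_surj[OF W] by blast
    have "form (bracket V X) X = 0" using E_skew[OF V(1), of X X] sym[of X] by simp
    then show ?thesis using bracket_skew[of X V] by (simp add: V(2) form_simps)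
  qed
  have H_E: "form Y W = 0" if Y: "(?D ^^ m) Y = 0" and W: "W \<in> E" for Y W
  proof -
    obtain V where V: "V \<in> E" "W = bracket X V" using E_surj[OF W] by blast
    have "bracket Y V \<in> E"
      by (rule bracket_fitting_components[OF _ E_sub E_X E_surj Y V(1)]) (auto simp: E_def)
    then have "form (bracket V Y) X = 0"
      using X_E bracket_skew[of V Y] by (simp add: form_simps)
    then show ?thesis
      using E_skew[OF V(1), of Y X] bracket_skew[of X V] by (simp add: V(2) form_simps)
  qed
  have H_X: "(?D ^^ m) (bracket X Y) = 0" if "(?D ^^ m) Y = 0" for Y
    using that funpow_swap1[of ?D m Y] linear_0[OF linear_ad, of X] by (simp add: ad_def)
  obtain s n where J: "additive_jordan_decomposition ?D s n"
    using additive_jordan_decomposition_exists[OF linear_ad finite_dim] .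
  have HH: "form (bracket X Y) Z = - form Y (bracket X Z)"
    if "(?D ^^ m) Y = 0" "(?D ^^ m) Z = 0" for Y Z
  proof -
    have "n Y = bracket X Y" "n Z = bracket X Z"
      using jordan_nilpotent_part_on_generalized_kernel[OF J] that by (simp_all add: ad_def)
    then show ?thesis using nil J unfolding nil_invariant_form_def by metis
  qed
  have EE: "form (bracket X Y) Z = - form Y (bracket X Z)" if "Y \<in> E" "Z \<in> E" for Y Z
  proof -
    \<comment> \<open>Antisymmetry of the right-hand side in \<open>A\<close> and \<open>B\<close> makes \<open>ad X\<close> skew here.\<close>
    have *: "form (bracket X A) B = form X (bracket A B)" if "A \<in> E" for A B
      using E_skew[OF that, of X B] bracket_skew[of X A] by (simp add: form_simps)
    have "form X (bracket Y Z) = - form X (bracket Z Y)"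
      using bracket_skew[of Y Z] by (simp add: form_simps)
    then show ?thesis using *[OF that(1), of Z] *[OF that(2), of Y] sym[of Y] by simp
  qed
  show ?thesis
    unfolding ad_skew_def
  proof (intro allI)
    fix Y Z
    obtain Y0 Y1 where Y: "Y = Y0 + Y1" "(?D ^^ m) Y0 = 0" "Y1 \<in> E"
      using m(1)[of Y] by (auto simp: E_def)
    obtain Z0 Z1 where Z: "Z = Z0 + Z1" "(?D ^^ m) Z0 = 0" "Z1 \<in> E"
      using m(1)[of Z] by (auto simp: E_def)
    have "form (bracket X Y0) Z1 = 0" "form Y0 (bracket X Z1) = 0"
      "form (bracket X Y1) Z0 = 0" "form Y1 (bracket X Z0) = 0"
      using H_E H_X E_X Y Z sym by metis+
    then show "form (bracket X Y) Z = - form Y (bracket X Z)"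
      using HH[OF Y(2) Z(2)] EE[OF Y(3) Z(3)] by (simp add: Y(1) Z(1) form_simps bracket_simps)
  qed
qed

theorem theorem1p2:
  fixes bracket :: "'a::real_vector \<Rightarrow> 'a \<Rightarrow> 'a"
    and form :: "'a \<Rightarrow> 'a \<Rightarrow> real"
  assumes "finite_dim_real_lie_algebra bracket"
    and "solvable_lie bracket"
    and "symmetric_bilinear_form form"
    and "nil_invariant_form bracket form"
  shows "invariant_form bracket form"
proof -
  interpret finite_dim_real_lie_algebra bracket by fact
  have bil: "bilinear form" and sym: "\<And>Y Z. form Y Z = form Z Y"
    using assms(3) by (auto simp: symmetric_bilinear_form_def)
  obtain k where k: "derived_series bracket k = {0}"
    using assms(2) by (auto simp: solvable_lie_def)
  have "\<forall>X\<in>derived_series bracket 0. ad_skew bracket form X"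
  proof (rule inc_induct[of 0 k])
    show "\<forall>X\<in>derived_series bracket k. ad_skew bracket form X"
      by (simp add: k ad_skew_def bracket_simps bilinear_lzero[OF bil] bilinear_rzero[OF bil])
  next
    fix j assume "\<forall>X\<in>derived_series bracket (Suc j). ad_skew bracket form X"
    then show "\<forall>X\<in>derived_series bracket j. ad_skew bracket form X"
      using ad_skew_if_ad_skew_on_next_derived[OF bil sym assms(4)] by blast
  qed simp
  then show ?thesis by (auto simp: ad_skew_def invariant_form_def)
qed

end
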